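(* Let $k$ be an algebraically closed field of characteristic $2$, and let $i_1,\dots,i_s\in\{1,\dots,m\}$. If the indices $i_1,\dots,i_s$ are all different, then the $O(3)$-invariant $\mathrm{Tr}^{(i_1,\dots,i_s)}\in R_{3\times m}^{O(3)}$ is not expressible as a polynomial in $O(3)$-invariants of lower degree.
   Context: $k$ is an algebraically closed field of characteristic $2$. $O(3)$ is the group of linear automorphisms of $k^3$ (coordinates $x,y,z$) preserving the quadratic form $q=xy+z^2$. $R_{3\times m}=k[x^{(i)},y^{(i)},z^{(i)}:1\le i\le m]$ is the algebra of polynomials in the coordinates of $m$ indeterminate vectors $v^{(i)}=(x^{(i)},y^{(i)},z^{(i)})$, with $O(3)$ acting diagonally; $R_{3\times m}^{O(3)}$ is the subalgebra of invariants. Degree means total degree. To $v^{(i)}$ associate the $2\times 2$ matrix $V^{(i)}=\begin{pmatrix} z^{(i)} & x^{(i)}\\ y^{(i)} & z^{(i)}\end{pmatrix}$, so that $\det V^{(i)}=q(v^{(i)})$. For $i_1,\dots,i_s\in\{1,\dots,m\}$ define $\mathrm{Tr}^{(i_1,\dots,i_s)}=\mathrm{Tr}\left(V^{(i_1)}\cdots V^{(i_s)}\right)$, the trace of the matrix product; it is an element of $R_{3\times m}^{O(3)}$.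
   Formalization: The number of indices s is required to be at least 2: for s = 1 the trace is 2z = 0 in characteristic 2 (and for s = 0 it is 2 = 0), which is trivially a polynomial in invariants of lower degree, so the claim fails there. *)

theory Defs
  imports "HOL-Analysis.Analysis" "HOL-Library.Poly_Mapping"
    "HOL-Computational_Algebra.Computational_Algebra"
begin

text \<open>
  Polynomials in variables of type \<open>'v\<close>: finitely supported maps from exponent vectors to
  coefficients, multiplied by convolution.
\<close>

type_synonym ('v, 'k) mvpoly = "('v \<Rightarrow>\<^sub>0 nat) \<Rightarrow>\<^sub>0 'k"

definition Var :: "'v \<Rightarrow> ('v, 'k::comm_ring_1) mvpoly" where
  "Var v = Poly_Mapping.single (Poly_Mapping.single v 1) 1"

definition Const :: "'k::comm_ring_1 \<Rightarrow> ('v, 'k) mvpoly" where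
  "Const c = Poly_Mapping.single 0 c"

definition vars :: "('v, 'k::comm_ring_1) mvpoly \<Rightarrow> 'v set" where
  "vars p = (\<Union>e\<in>Poly_Mapping.keys p. Poly_Mapping.keys e)"

text \<open>The total degree, with the convention that the zero polynomial has degree 0.\<close>

definition total_degree :: "('v, 'k::comm_ring_1) mvpoly \<Rightarrow> nat" where
  "total_degree p =
     Max (insert 0 ((\<lambda>e. \<Sum>v\<in>Poly_Mapping.keys e. Poly_Mapping.lookup e v) ` Poly_Mapping.keys p))"

definition subst ::
  "('v \<Rightarrow> ('w, 'k) mvpoly) \<Rightarrow> ('v, 'k::comm_ring_1) mvpoly \<Rightarrow> ('w, 'k) mvpoly" where
  "subst f p =
     (\<Sum>e\<in>Poly_Mapping.keys p. Const (Poly_Mapping.lookup p e) *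
        (\<Prod>v\<in>Poly_Mapping.keys e. f v ^ Poly_Mapping.lookup e v))"

definition qform :: "'k::comm_ring_1 ^ 3 \<Rightarrow> 'k" where
  "qform v = v $ 1 * v $ 2 + (v $ 3)\<^sup>2"

text \<open>Linear automorphisms of \<open>k\<^sup>3\<close>, given by their matrices in the standard basis.\<close>

definition O3 :: "('k::field ^ 3 ^ 3) set" where
  "O3 = {A. invertible A \<and> (\<forall>v. qform (A *v v) = qform v)}"

text \<open>
  The variables are pairs \<open>(i, j)\<close>, where \<open>i\<close> numbers the vector and \<open>j = 1, 2, 3\<close> stands
  for the coordinate \<open>x, y, z\<close> respectively; \<open>gvec i\<close> is the indeterminate vector number \<open>i\<close>.
\<close>

definition gvec :: "nat \<Rightarrow> (nat \<times> 3, 'k::comm_ring_1) mvpoly ^ 3" where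
  "gvec i = (\<chi> j. Var (i, j))"

definition R3 :: "nat \<Rightarrow> (nat \<times> 3, 'k::comm_ring_1) mvpoly set" where
  "R3 m = {p. vars p \<subseteq> {1..m} \<times> UNIV}"

text \<open>
  The diagonal action replaces every \<open>gvec i\<close> by \<open>A (gvec i)\<close>. On polynomial functions this is
  precomposition with \<open>A\<close>, hence a right action; the left action uses the inverse of \<open>A\<close> and
  has the same invariants.
\<close>

definition act ::
  "'k ^ 3 ^ 3 \<Rightarrow> (nat \<times> 3, 'k::comm_ring_1) mvpoly \<Rightarrow> (nat \<times> 3, 'k) mvpoly" where
  "act A = subst (\<lambda>(i, j). ((\<chi> a b. Const (A $ a $ b)) *v gvec i) $ j)"

definition invariants :: "nat \<Rightarrow> (nat \<times> 3, 'k::field) mvpoly set" where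
  "invariants m = {p \<in> R3 m. \<forall>A\<in>O3. act A p = p}"

definition Vmat :: "nat \<Rightarrow> (nat \<times> 3, 'k::comm_ring_1) mvpoly ^ 2 ^ 2" where
  "Vmat i = vector [vector [gvec i $ 3, gvec i $ 1],
                 vector [gvec i $ 2, gvec i $ 3]]"

lemma det_Vmat: "det (Vmat i) = (gvec i $ 3)\<^sup>2 - gvec i $ 1 * gvec i $ 2"
  by (simp add: det_2 Vmat_def power2_eq_square)

definition Tr :: "nat list \<Rightarrow> (nat \<times> 3, 'k::comm_ring_1) mvpoly" where
  "Tr idx = trace (foldr (\<lambda>i M. Vmat i ** M) idx (mat 1))"

text \<open>
  \<open>p\<close> is a polynomial expression \<open>P(f\<^sub>0, f\<^sub>1, \<dots>)\<close> in finitely many invariants of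
  lower degree. Only the \<open>f j\<close> whose variable occurs in \<open>P\<close> matter.
\<close>

definition expressible_by_lower_invariants :: "nat \<Rightarrow> (nat \<times> 3, 'k::field) mvpoly \<Rightarrow> bool" where
  "expressible_by_lower_invariants m p \<longleftrightarrow>
     (\<exists>(P :: (nat, 'k) mvpoly) f.
        (\<forall>j\<in>vars P. f j \<in> invariants m \<and> total_degree (f j) < total_degree p) \<and>
        p = subst f P)"

text \<open>
  In characteristic 2 the trace attached to a single index is \<open>2 z = 0\<close>, which is
  expressible by the zero polynomial; statements about indecomposability need at least two indices.
\<close>

lemma Tr_singleton: "Tr [i] = 2 * gvec i $ 3"
  by (simp add: Tr_def trace_def Vmat_def sum_2)

lemma Tr_singleton_expressible:
  assumes "CHAR('k::field) = 2"
  shows "expressible_by_lower_invariants m (Tr [i] :: (nat \<times> 3, 'k) mvpoly)"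
proof -
  have "of_nat 2 = (0 :: 'k)"
    using assms by (metis of_nat_CHAR)
  hence "(2 :: (nat \<times> 3, 'k) mvpoly) = 0"
    by (metis of_nat_numeral single_of_nat single_zero)
  hence "(Tr [i] :: (nat \<times> 3, 'k) mvpoly) = subst f 0" for f :: "nat \<Rightarrow> _"
    by (simp add: Tr_singleton subst_def)
  thus ?thesis
    unfolding expressible_by_lower_invariants_def by (intro exI[of _ 0]) (auto simp: vars_def)
qed

end

theory Submission
  imports Defs
begin

text \<open>
  Write the index list as \<open>i, j, l\<^sub>1, \<dots>, l\<^sub>r\<close>. The proof follows one coefficient, that of the squarefree
  monomial \<open>x\<^sub>i y\<^sub>j z\<^sub>l\<close>, where \<open>z\<^sub>l\<close> is the product of the \<open>z\<close>-coordinates of the remaining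
  vectors. In the trace of the product of the matrices it is 1: the factor \<open>x\<^sub>i\<close> is an off-diagonal step
  \<open>1 \<rightarrow> 2\<close>, \<open>y\<^sub>j\<close> is the step back, and all other factors are diagonal (\<open>sqfree_coeff_Tr\<close>).
  It remains to see that no polynomial in invariants of lower degree contains this monomial.

  In characteristic 2 the polar form of \<open>xy + z\<^sup>2\<close> is degenerate; its radical is spanned by
  \<open>e\<^sub>z\<close>, and isometries fix \<open>e\<^sub>z\<close>. Hence, if in an invariant all vectors but one are restricted to multiples of
  \<open>e\<^sub>z\<close>, the part that is linear in the remaining vector is an invariant linear form
  (\<open>sqfree_coeff_act_fixing_radical\<close>). There is no nonzero invariant linear form on
  \<open>k\<^sup>3\<close>: the transvections \<open>x \<mapsto> x + b\<^sup>2 y, z \<mapsto> z + b y\<close> for two nonzero values of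
  \<open>b\<close> and the exchange of \<open>x\<close> and \<open>y\<close> rule it out. So an invariant contains none of the
  monomials \<open>z\<^sub>B\<close> with \<open>B\<close> nonempty, \<open>x\<^sub>n z\<^sub>B\<close> and \<open>y\<^sub>n z\<^sub>B\<close>
  with \<open>n \<notin> B\<close> (\<open>sqfree_coeff_invariant_eq_0\<close>).

  Among the divisors of \<open>x\<^sub>i y\<^sub>j z\<^sub>l\<close> an invariant therefore contains at most 1 and multiples
  of \<open>x\<^sub>i y\<^sub>j\<close>. Two multiples of \<open>x\<^sub>i y\<^sub>j\<close> never multiply to a
  divisor of a squarefree monomial, so products create the full monomial only if one of the factors
  contains it already. Invariants of lower degree do not contain it, for reasons of degree, and these
  properties persist under sums and products (\<open>avoids_mult\<close>).
\<close>

section \<open>Squarefree coefficients\<close>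

definition squarefree_monom :: "'v set \<Rightarrow> ('v \<Rightarrow>\<^sub>0 nat)" where
  "squarefree_monom S = (\<Sum>v\<in>S. Poly_Mapping.single v 1)"

definition sqfree_coeff :: "('v, 'k::comm_ring_1) mvpoly \<Rightarrow> 'v set \<Rightarrow> 'k" where
  "sqfree_coeff p S = Poly_Mapping.lookup p (squarefree_monom S)"

lemma lookup_squarefree_monom:
  assumes "finite S"
  shows "Poly_Mapping.lookup (squarefree_monom S) v = (if v \<in> S then 1 else 0)"
  using assms by (simp add: squarefree_monom_def lookup_sum lookup_single when_def)

lemma keys_squarefree_monom: "finite S \<Longrightarrow> Poly_Mapping.keys (squarefree_monom S) = S"
  by (auto simp: in_keys_iff lookup_squarefree_monom split: if_splits)

lemma squarefree_monom_eq_iff: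
  "finite S \<Longrightarrow> finite T \<Longrightarrow> squarefree_monom S = squarefree_monom T \<longleftrightarrow> S = T"
  by (metis keys_squarefree_monom)

text \<open>
  A factorization of a squarefree monomial is a splitting of its set of variables. This is what turns
  polynomial multiplication into a convolution over subsets in \<open>sqfree_coeff_mult\<close>.
\<close>

lemma add_eq_squarefree_monom_iff:
  assumes "finite S"
  shows "a + b = squarefree_monom S \<longleftrightarrow>
    (\<exists>T\<subseteq>S. a = squarefree_monom T \<and> b = squarefree_monom (S - T))"
proof
  assume eq: "a + b = squarefree_monom S"
  have L: "Poly_Mapping.lookup a v + Poly_Mapping.lookup b v = (if v \<in> S then 1 else 0)" for v
    using arg_cong[OF eq, of "\<lambda>x. Poly_Mapping.lookup x v"] assms
    by (simp add: lookup_add lookup_squarefree_monom)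
  let ?T = "Poly_Mapping.keys a"
  have "?T \<subseteq> S"
    using L by (metis add_is_0 in_keys_iff subsetI)
  moreover from this have fin: "finite ?T" "finite (S - ?T)"
    using assms by auto
  have "a = squarefree_monom ?T"
  proof (rule poly_mapping_eqI)
    fix v show "Poly_Mapping.lookup a v = Poly_Mapping.lookup (squarefree_monom ?T) v"
      using L[of v] fin by (auto simp: lookup_squarefree_monom in_keys_iff split: if_splits)
  qed
  moreover have "b = squarefree_monom (S - ?T)"
  proof (rule poly_mapping_eqI)
    fix v show "Poly_Mapping.lookup b v = Poly_Mapping.lookup (squarefree_monom (S - ?T)) v"
      using L[of v] fin by (auto simp: lookup_squarefree_monom in_keys_iff split: if_splits)
  qed
  ultimately show "\<exists>T\<subseteq>S. a = squarefree_monom T \<and> b = squarefree_monom (S - T)" by blast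
next
  assume "\<exists>T\<subseteq>S. a = squarefree_monom T \<and> b = squarefree_monom (S - T)"
  then obtain T where T: "T \<subseteq> S" "a = squarefree_monom T" "b = squarefree_monom (S - T)" by blast
  show "a + b = squarefree_monom S"
    unfolding T squarefree_monom_def using sum.subset_diff[OF T(1) assms]
    by (metis add.commute)
qed

lemma sqfree_coeff_add: "sqfree_coeff (p + q) S = sqfree_coeff p S + sqfree_coeff q S"
  by (simp add: sqfree_coeff_def lookup_add)

lemma sqfree_coeff_sum: "sqfree_coeff (sum f X) S = (\<Sum>x\<in>X. sqfree_coeff (f x) S)"
  by (simp add: sqfree_coeff_def lookup_sum)

lemma sqfree_coeff_Const:
  "finite S \<Longrightarrow> sqfree_coeff (Const c) S = (if S = {} then c else 0)"
  using squarefree_monom_eq_iff[of "{}" S]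
  by (auto simp: sqfree_coeff_def Const_def lookup_single when_def squarefree_monom_def)

lemma sqfree_coeff_one: "finite S \<Longrightarrow> sqfree_coeff 1 S = (if S = {} then 1 else 0)"
  using sqfree_coeff_Const[of S 1] by (simp add: Const_def)

lemma sqfree_coeff_Var:
  "finite S \<Longrightarrow> sqfree_coeff (Var v) S = (if S = {v} then 1 else 0)"
  using squarefree_monom_eq_iff[of "{v}" S]
  by (auto simp: sqfree_coeff_def Var_def lookup_single when_def squarefree_monom_def)

lemma poly_mapping_eq_sum_single:
  "p = (\<Sum>e\<in>Poly_Mapping.keys p. Poly_Mapping.single e (Poly_Mapping.lookup p e))"
  by (rule poly_mapping_eqI) (auto simp: lookup_sum lookup_single when_def in_keys_iff)

text \<open>Both sides are bilinear, so the claim reduces to single terms.\<close>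

lemma sqfree_coeff_mult:
  fixes p q :: "('v, 'k::comm_ring_1) mvpoly"
  assumes S: "finite S"
  shows "sqfree_coeff (p * q) S = (\<Sum>T\<in>Pow S. sqfree_coeff p T * sqfree_coeff q (S - T))"
proof -
  have monom: "sqfree_coeff (Poly_Mapping.single a c * Poly_Mapping.single b d) S =
      (\<Sum>T\<in>Pow S. sqfree_coeff (Poly_Mapping.single a c) T *
         sqfree_coeff (Poly_Mapping.single b d) (S - T))"
    for a b :: "'v \<Rightarrow>\<^sub>0 nat" and c d :: 'k
  proof (cases "a + b = squarefree_monom S")
    case True
    then obtain U where U: "U \<subseteq> S" "a = squarefree_monom U" "b = squarefree_monom (S - U)"
      using add_eq_squarefree_monom_iff[OF S] by blast
    have fin: "finite T" if "T \<subseteq> S" for T using that S finite_subset by blast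
    have "(\<Sum>T\<in>Pow S. sqfree_coeff (Poly_Mapping.single a c) T *
         sqfree_coeff (Poly_Mapping.single b d) (S - T)) =
      (\<Sum>T\<in>Pow S. if T = U then c * d else 0)"
      using U S by (intro sum.cong)
        (auto simp: sqfree_coeff_def lookup_single when_def squarefree_monom_eq_iff fin)
    also have "\<dots> = c * d"
      using S U by simp
    finally show ?thesis
      using True by (simp add: sqfree_coeff_def mult_single)
  next
    case False
    then have "sqfree_coeff (Poly_Mapping.single a c) T *
         sqfree_coeff (Poly_Mapping.single b d) (S - T) = 0" if "T \<subseteq> S" for T
      using that add_eq_squarefree_monom_iff[OF S, of a b]
      by (auto simp: sqfree_coeff_def lookup_single when_def)
    then show ?thesis
      using False by (auto simp: sqfree_coeff_def mult_single lookup_single when_def)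
  qed
  define P where "P e = Poly_Mapping.single e (Poly_Mapping.lookup p e)" for e
  define Q where "Q e = Poly_Mapping.single e (Poly_Mapping.lookup q e)" for e
  have p: "p = sum P (Poly_Mapping.keys p)" and q: "q = sum Q (Poly_Mapping.keys q)"
    unfolding P_def Q_def by (rule poly_mapping_eq_sum_single)+
  have "sqfree_coeff (p * q) S =
      (\<Sum>a\<in>Poly_Mapping.keys p. \<Sum>b\<in>Poly_Mapping.keys q. sqfree_coeff (P a * Q b) S)"
    by (subst p, subst q) (simp add: sum_product sqfree_coeff_sum)
  also have "\<dots> = (\<Sum>a\<in>Poly_Mapping.keys p. \<Sum>b\<in>Poly_Mapping.keys q.
      \<Sum>T\<in>Pow S. sqfree_coeff (P a) T * sqfree_coeff (Q b) (S - T))"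
    unfolding P_def Q_def monom ..
  also have "\<dots> = (\<Sum>a\<in>Poly_Mapping.keys p. \<Sum>T\<in>Pow S. \<Sum>b\<in>Poly_Mapping.keys q.
      sqfree_coeff (P a) T * sqfree_coeff (Q b) (S - T))"
    by (rule sum.cong[OF refl], rule sum.swap)
  also have "\<dots> = (\<Sum>T\<in>Pow S. \<Sum>a\<in>Poly_Mapping.keys p. \<Sum>b\<in>Poly_Mapping.keys q.
      sqfree_coeff (P a) T * sqfree_coeff (Q b) (S - T))"
    by (rule sum.swap)
  also have "\<dots> = (\<Sum>T\<in>Pow S. sqfree_coeff (sum P (Poly_Mapping.keys p)) T *
      sqfree_coeff (sum Q (Poly_Mapping.keys q)) (S - T))"
    by (simp add: sum_product sqfree_coeff_sum)
  finally show ?thesis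
    by (simp only: p[symmetric] q[symmetric])
qed

text \<open>
  The Leibniz form of the convolution: the distinguished variable goes to one of the two factors.
\<close>

lemma sqfree_coeff_mult_insert:
  fixes p q :: "('v, 'k::comm_ring_1) mvpoly"
  assumes S: "finite S" and v: "v \<notin> S"
  shows "sqfree_coeff (p * q) (insert v S) =
    (\<Sum>T\<in>Pow S. sqfree_coeff p (insert v T) * sqfree_coeff q (S - T)
       + sqfree_coeff p T * sqfree_coeff q (insert v (S - T)))"
proof -
  define g where "g T = sqfree_coeff p T * sqfree_coeff q (insert v S - T)" for T
  have disj: "Pow S \<inter> insert v ` Pow S = {}" and inj: "inj_on (insert v) (Pow S)"
    using v by (auto simp: inj_on_def)
  have "sqfree_coeff (p * q) (insert v S) = sum g (Pow S) + sum g (insert v ` Pow S)"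
    using S disj by (simp add: sqfree_coeff_mult g_def Pow_insert sum.union_disjoint)
  also have "sum g (insert v ` Pow S) = (\<Sum>T\<in>Pow S. g (insert v T))"
    by (simp add: sum.reindex[OF inj])
  also have "sum g (Pow S) + \<dots> = (\<Sum>T\<in>Pow S. g (insert v T) + g T)"
    by (simp add: sum.distrib add.commute)
  also have "\<dots> = (\<Sum>T\<in>Pow S. sqfree_coeff p (insert v T) * sqfree_coeff q (S - T)
       + sqfree_coeff p T * sqfree_coeff q (insert v (S - T)))"
  proof (rule sum.cong[OF refl])
    fix T assume "T \<in> Pow S"
    then have "insert v S - insert v T = S - T" "insert v S - T = insert v (S - T)"
      using v by auto
    then show "g (insert v T) + g T = sqfree_coeff p (insert v T) * sqfree_coeff q (S - T)
       + sqfree_coeff p T * sqfree_coeff q (insert v (S - T))"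
      by (simp add: g_def)
  qed
  finally show ?thesis .
qed

lemma sqfree_coeff_Var_mult:
  assumes S: "finite S"
  shows "sqfree_coeff (Var v * p) S = (if v \<in> S then sqfree_coeff p (S - {v}) else 0)"
proof -
  have "sqfree_coeff (Var v * p) S =
      (\<Sum>T\<in>Pow S. if T = {v} then sqfree_coeff p (S - {v}) else 0)"
    unfolding sqfree_coeff_mult[OF S] using S
    by (intro sum.cong) (auto simp: sqfree_coeff_Var finite_subset)
  then show ?thesis
    using S by simp
qed

section \<open>Substitution\<close>

text \<open>
  A relation compatible with the ring operations passes from the substituted polynomials to the
  results. It serves for subalgebras, as a relation that ignores one of its arguments, and with
  \<open>f = Var\<close> for the comparison of a polynomial with its image under a
  substitution.
\<close>

lemma subst_related:
  assumes R_Const: "\<And>c. R (Const c) (Const c)"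
    and R_add: "\<And>p p' q q'. R p p' \<Longrightarrow> R q q' \<Longrightarrow> R (p + q) (p' + q')"
    and R_mult: "\<And>p p' q q'. R p p' \<Longrightarrow> R q q' \<Longrightarrow> R (p * q) (p' * q')"
    and R_vars: "\<And>v. v \<in> vars P \<Longrightarrow> R (f v) (g v)"
  shows "R (subst f P) (subst g P)"
proof -
  have zero: "R 0 0" and one: "R 1 1"
    using R_Const[of 0] R_Const[of 1] by (simp_all add: Const_def)
  have pow: "R (f v ^ n) (g v ^ n)" if "v \<in> vars P" for v n
    by (induction n) (auto intro: one R_mult R_vars that)
  have prod: "R (\<Prod>v\<in>X. f v ^ n v) (\<Prod>v\<in>X. g v ^ n v)" if "X \<subseteq> vars P" for X n
    using that by (induction X rule: infinite_finite_induct) (auto intro: one R_mult pow)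
  have "R (\<Sum>e\<in>Y. Const (Poly_Mapping.lookup P e) *
             (\<Prod>v\<in>Poly_Mapping.keys e. f v ^ Poly_Mapping.lookup e v))
          (\<Sum>e\<in>Y. Const (Poly_Mapping.lookup P e) *
             (\<Prod>v\<in>Poly_Mapping.keys e. g v ^ Poly_Mapping.lookup e v))"
    if "Y \<subseteq> Poly_Mapping.keys P" for Y
    using that
    by (induction Y rule: infinite_finite_induct)
      (auto intro!: zero R_add R_mult R_Const prod simp: vars_def)
  then show ?thesis
    by (simp add: subst_def)
qed

lemma Var_power: "Var v ^ n = Poly_Mapping.single (Poly_Mapping.single v n) 1"
  by (induction n) (simp_all add: Var_def mult_single single_add[symmetric])

lemma prod_single_one:
  "(\<Prod>v\<in>X. Poly_Mapping.single (h v) (1::'k::comm_ring_1)) =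
     Poly_Mapping.single (\<Sum>v\<in>X. h v :: 'v \<Rightarrow>\<^sub>0 nat) 1"
  by (induction X rule: infinite_finite_induct) (simp_all add: mult_single)

lemma subst_Var: "subst Var p = p"
proof -
  have "subst Var p = (\<Sum>e\<in>Poly_Mapping.keys p. Poly_Mapping.single e (Poly_Mapping.lookup p e))"
    unfolding subst_def
    by (intro sum.cong refl)
      (simp add: Const_def Var_power prod_single_one mult_single
        poly_mapping_eq_sum_single[symmetric])
  then show ?thesis
    by (simp only: poly_mapping_eq_sum_single[symmetric])
qed

section \<open>Coefficients of invariants along the radical\<close>

abbreviation zvars :: "nat set \<Rightarrow> (nat \<times> 3) set" where
  "zvars B \<equiv> (\<lambda>i. (i, 3)) ` B"

text \<open>
  The condition on the third column says that \<open>A\<close> fixes the basis vector \<open>e\<^sub>z\<close>. The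
  coefficients of \<open>z\<^sub>B\<close> describe \<open>p\<close> where all vectors are multiples of \<open>e\<^sub>z\<close>,
  and are unchanged; those of \<open>z\<^sub>B\<close> times a coordinate of vector \<open>j\<close> describe the linear part
  in a further vector, and transform like a linear form. Both statements are proved together, because
  the second one for a product involves the first one for the factors.
\<close>

lemma sqfree_coeff_act_fixing_radical:
  fixes A :: "'k::comm_ring_1 ^ 3 ^ 3" and p :: "(nat \<times> 3, 'k) mvpoly"
  assumes fix_z: "\<And>a. A $ a $ 3 = (if a = 3 then 1 else 0)"
    and B: "finite B" "j \<notin> B"
  shows "sqfree_coeff (act A p) (insert (j, c) (zvars B)) =
    (\<Sum>a\<in>UNIV. A $ a $ c * sqfree_coeff p (insert (j, a) (zvars B)))"
proof -
  define R where "R p p' \<longleftrightarrow> (\<forall>B. finite B \<longrightarrow> j \<notin> B \<longrightarrow>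
      sqfree_coeff p' (zvars B) = sqfree_coeff p (zvars B) \<and>
      (\<forall>c. sqfree_coeff p' (insert (j, c) (zvars B)) =
         (\<Sum>a\<in>UNIV. A $ a $ c * sqfree_coeff p (insert (j, a) (zvars B)))))"
    for p p' :: "(nat \<times> 3, 'k) mvpoly"
  \<comment> \<open>The substitution that defines \<open>act A\<close>.\<close>
  define g where "g = (\<lambda>(i, j). ((\<chi> a b. Const (A $ a $ b)) *v gvec i) $ j)"
  have "R (subst Var p) (subst g p)"
  proof (rule subst_related)
    show "R (Const c) (Const c)" for c
      by (simp add: R_def sqfree_coeff_Const)
  next
    show "R (p + q) (p' + q')" if "R p p'" "R q q'" for p p' q q'
      using that by (simp add: R_def sqfree_coeff_add distrib_left sum.distrib)
  next
    fix p p' q q' assume p: "R p p'" and q: "R q q'"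
    show "R (p * q) (p' * q')"
      unfolding R_def
    proof (intro allI impI conjI)
      fix B :: "nat set" assume B: "finite B" "j \<notin> B"
      have z: "sqfree_coeff x' (zvars D) = sqfree_coeff x (zvars D)"
        if "R x x'" "finite D" "j \<notin> D" for x x' D
        using that(1)[unfolded R_def, rule_format, OF that(2,3)] by (rule conjunct1)
      have j: "sqfree_coeff x' (insert (j, c) (zvars D)) =
          (\<Sum>a\<in>UNIV. A $ a $ c * sqfree_coeff x (insert (j, a) (zvars D)))"
        if "R x x'" "finite D" "j \<notin> D" for x x' D c
        using that(1)[unfolded R_def, rule_format, OF that(2,3)] by (rule conjunct2[THEN spec])
      have sub: "\<exists>D. finite D \<and> j \<notin> D \<and> T = zvars D"
        if "T \<subseteq> zvars B" for T
      proof -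
        obtain D where D: "D \<subseteq> B" "T = zvars D"
          using \<open>T \<subseteq> zvars B\<close> by (elim subset_imageE)
        have "finite D" using D(1) B(1) by (rule finite_subset)
        moreover have "j \<notin> D" using D(1) B(2) by blast
        ultimately show ?thesis using D(2) by blast
      qed
      have T: "sqfree_coeff p' T = sqfree_coeff p T"
        "sqfree_coeff q' (zvars B - T) = sqfree_coeff q (zvars B - T)"
        "sqfree_coeff p' (insert (j, c) T) =
          (\<Sum>a\<in>UNIV. A $ a $ c * sqfree_coeff p (insert (j, a) T))"
        "sqfree_coeff q' (insert (j, c) (zvars B - T)) =
          (\<Sum>a\<in>UNIV. A $ a $ c * sqfree_coeff q (insert (j, a) (zvars B - T)))"
        if "T \<in> Pow (zvars B)" for T c
      proof -
        have sub_T: "T \<subseteq> zvars B" "zvars B - T \<subseteq> zvars B" using that by simp_all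
        obtain D where D: "finite D" "j \<notin> D" "T = zvars D"
          using sub[OF sub_T(1)] by (elim exE conjE)
        obtain E where E: "finite E" "j \<notin> E" "zvars B - T = zvars E"
          using sub[OF sub_T(2)] by (elim exE conjE)
        show "sqfree_coeff p' T = sqfree_coeff p T"
          unfolding D(3) by (rule z[OF p D(1,2)])
        show "sqfree_coeff q' (zvars B - T) = sqfree_coeff q (zvars B - T)"
          unfolding E(3) by (rule z[OF q E(1,2)])
        show "sqfree_coeff p' (insert (j, c) T) =
            (\<Sum>a\<in>UNIV. A $ a $ c * sqfree_coeff p (insert (j, a) T))"
          unfolding D(3) by (rule j[OF p D(1,2)])
        show "sqfree_coeff q' (insert (j, c) (zvars B - T)) =
            (\<Sum>a\<in>UNIV. A $ a $ c * sqfree_coeff q (insert (j, a) (zvars B - T)))"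
          unfolding E(3) by (rule j[OF q E(1,2)])
      qed
      show "sqfree_coeff (p' * q') (zvars B) = sqfree_coeff (p * q) (zvars B)"
        using B T(1,2) by (simp add: sqfree_coeff_mult)
      fix c
      have notin: "(j, a) \<notin> zvars B" for a using B by auto
      have "(\<Sum>a\<in>UNIV. A $ a $ c * sqfree_coeff (p * q) (insert (j, a) (zvars B))) =
        (\<Sum>a\<in>UNIV. \<Sum>T\<in>Pow (zvars B). A $ a $ c *
           (sqfree_coeff p (insert (j, a) T) * sqfree_coeff q (zvars B - T)
            + sqfree_coeff p T * sqfree_coeff q (insert (j, a) (zvars B - T))))"
        using B by (simp add: sqfree_coeff_mult_insert notin sum_distrib_left)
      also have "\<dots> = (\<Sum>T\<in>Pow (zvars B). \<Sum>a\<in>UNIV. A $ a $ c *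
           (sqfree_coeff p (insert (j, a) T) * sqfree_coeff q (zvars B - T)
            + sqfree_coeff p T * sqfree_coeff q (insert (j, a) (zvars B - T))))"
        by (rule sum.swap)
      also have "\<dots> = (\<Sum>T\<in>Pow (zvars B).
           sqfree_coeff p' (insert (j, c) T) * sqfree_coeff q' (zvars B - T)
            + sqfree_coeff p' T * sqfree_coeff q' (insert (j, c) (zvars B - T)))"
        by (rule sum.cong[OF refl])
          (simp add: T sum_distrib_left sum_distrib_right sum.distrib algebra_simps)
      also have "\<dots> = sqfree_coeff (p' * q') (insert (j, c) (zvars B))"
        using B by (simp add: sqfree_coeff_mult_insert notin)
      finally show "sqfree_coeff (p' * q') (insert (j, c) (zvars B)) =
         (\<Sum>a\<in>UNIV. A $ a $ c * sqfree_coeff (p * q) (insert (j, a) (zvars B)))" ..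
    qed
  next
    fix v :: "nat \<times> 3"
    obtain i a where v: "v = (i, a)" by (cases v)
    have g: "sqfree_coeff (g v) S = (\<Sum>b\<in>UNIV. if S = {(i, b)} then A $ a $ b else 0)"
      if "finite S" for S
    proof -
      have "sqfree_coeff (Const k * Var w) S = (if S = {w} then k else 0)" for k :: 'k and w
        using that by (subst mult.commute)
          (auto simp: sqfree_coeff_Var_mult sqfree_coeff_Const)
      then show ?thesis
        by (simp add: g_def v matrix_vector_mult_def gvec_def sqfree_coeff_sum)
    qed
    show "R (Var v) (g v)"
      unfolding R_def
    proof (intro allI impI conjI)
      fix B :: "nat set" assume B: "finite B" "j \<notin> B"
      have sing: "zvars B = {(i, b)} \<longleftrightarrow> b = 3 \<and> B = {i}" for b
        by auto
      show "sqfree_coeff (g v) (zvars B) = sqfree_coeff (Var v) (zvars B)"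
        using B by (subst g) (auto simp: sqfree_coeff_Var v sing sum_3 fix_z)
      fix c
      have notin: "(j, a) \<notin> zvars B" for a using B by auto
      have sing': "insert (j, c) (zvars B) = {(i, b)} \<longleftrightarrow> B = {} \<and> i = j \<and> b = c" for b c
        using notin[of c] by auto
      have fin: "finite (insert (j, d) (zvars B))" for d using B by simp
      show "sqfree_coeff (g v) (insert (j, c) (zvars B)) =
         (\<Sum>a\<in>UNIV. A $ a $ c * sqfree_coeff (Var v) (insert (j, a) (zvars B)))"
        unfolding g[OF fin] sqfree_coeff_Var[OF fin] unfolding v sing'
        by (cases "B = {}"; cases "i = j") (simp_all add: if_distrib cong: if_cong)
    qed
  qed
  then show ?thesis
    using B by (simp add: R_def subst_Var act_def g_def)
qed

text \<open>
  The map \<open>x \<mapsto> x + b\<^sup>2 y\<close>, \<open>y \<mapsto> y\<close>, \<open>z \<mapsto> z + b y\<close>. It changes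
  \<open>xy\<close> and \<open>z\<^sup>2\<close> both by \<open>b\<^sup>2 y\<^sup>2\<close>, which cancels in characteristic 2.
\<close>

definition transvection :: "'k::comm_ring_1 \<Rightarrow> 'k ^ 3 ^ 3" where
  "transvection b = vector [vector [1, b\<^sup>2, 0], vector [0, 1, 0], vector [0, b, 1]]"

definition swap_xy :: "'k::comm_ring_1 ^ 3 ^ 3" where
  "swap_xy = vector [vector [0, 1, 0], vector [1, 0, 0], vector [0, 0, 1]]"

lemma CHAR_2_add_self:
  assumes "CHAR('k::comm_ring_1) = 2"
  shows "(x::'k) + x = 0"
proof -
  have "(2::'k) = 0" using assms by (metis of_nat_CHAR of_nat_numeral)
  then show ?thesis by (metis mult_2 mult_zero_left)
qed

lemma transvection_O3:
  assumes "CHAR('k::field) = 2"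
  shows "transvection (b::'k) \<in> O3"
proof -
  note [simp] = CHAR_2_add_self[OF assms]
  have cancel: "x + (x + y) = y" for x y :: 'k
    by (simp add: add.assoc[symmetric])
  have "transvection b ** transvection b = mat 1"
    by (simp add: vec_eq_iff forall_3 matrix_matrix_mult_def transvection_def sum_3 mat_def)
  moreover have "qform (transvection b *v v) = qform v" for v
    by (simp add: qform_def matrix_vector_mult_def transvection_def sum_3 power2_eq_square
        algebra_simps cancel)
  ultimately show ?thesis
    by (auto simp: O3_def invertible_def)
qed

lemma swap_xy_O3: "(swap_xy :: 'k::field ^ 3 ^ 3) \<in> O3"
proof -
  have "(swap_xy :: 'k ^ 3 ^ 3) ** swap_xy = mat 1"
    by (simp add: vec_eq_iff forall_3 matrix_matrix_mult_def swap_xy_def sum_3 mat_def)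
  moreover have "qform (swap_xy *v v) = qform v" for v :: "'k ^ 3"
    by (simp add: qform_def matrix_vector_mult_def swap_xy_def sum_3 mult.commute)
  ultimately show ?thesis
    by (auto simp: O3_def invertible_def)
qed

text \<open>
  Over the field with two elements \<open>x + y + z\<close> is an invariant linear form, so a third
  scalar is essential. A root of \<open>1 + t + t\<^sup>2\<close> serves, unless it is 1.
\<close>

lemma exists_not_zero_one: "\<exists>t :: 'k::alg_closed_field. t \<noteq> 0 \<and> t \<noteq> 1"
proof -
  have "degree [:1, 1, 1 :: 'k:] > 0" by simp
  then obtain t :: 'k where t: "poly [:1, 1, 1:] t = 0"
    using alg_closed_imp_poly_has_root by blast
  show ?thesis
  proof (cases "t = 1")
    case False
    then show ?thesis using t by (intro exI[of _ t]) auto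
  next
    case True
    \<comment> \<open>The characteristic is 3 in this case, and 2 is the third scalar.\<close>
    then have "(1::'k) + (1 + 1) = 0" using t by simp
    then have "(1::'k) + 1 \<noteq> 0" by (metis add.right_neutral one_neq_zero)
    moreover have "(1::'k) + 1 \<noteq> 1" by (metis add_cancel_left_right one_neq_zero)
    ultimately show ?thesis by blast
  qed
qed

text \<open>
  As \<open>c\<close> runs through the coordinates, these are the coefficients of a linear form on
  \<open>k\<^sup>3\<close> that is invariant under \<open>O(3)\<close>, hence zero.
\<close>

lemma sqfree_coeff_invariant_eq_0:
  fixes p :: "(nat \<times> 3, 'k::alg_closed_field) mvpoly"
  assumes char: "CHAR('k) = 2" and p: "p \<in> invariants m" and B: "finite B" "j \<notin> B"
  shows "sqfree_coeff p (insert (j, c) (zvars B)) = 0"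
proof -
  define l where "l c = sqfree_coeff p (insert (j, c) (zvars B))" for c
  have l: "l c = (\<Sum>a\<in>UNIV. A $ a $ c * l a)"
    if "A \<in> O3" "\<And>a. A $ a $ 3 = (if a = 3 then 1 else 0)"
    for A :: "'k ^ 3 ^ 3" and c
    using sqfree_coeff_act_fixing_radical[of A B j p c] that p B
    by (simp add: l_def invariants_def)
  have tr: "b * (b * l 1 + l 3) = 0" for b
  proof -
    have "l 2 = (\<Sum>a\<in>UNIV. transvection b $ a $ 2 * l a)"
    proof (rule l)
      fix a :: 3 show "transvection b $ a $ 3 = (if a = 3 then 1 else 0)"
        using exhaust_3[of a] by (auto simp: transvection_def)
    qed (simp add: transvection_O3 char)
    then show ?thesis
      by (simp add: sum_3 transvection_def power2_eq_square algebra_simps)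
  qed
  obtain t :: 'k where t: "t \<noteq> 0" "t \<noteq> 1" using exists_not_zero_one by blast
  have "l 1 + l 3 = 0" "t * l 1 + l 3 = 0" using tr[of 1] tr[of t] t by simp_all
  then have "(t * l 1 + l 3) - (l 1 + l 3) = 0" by simp
  then have "(t - 1) * l 1 = 0" by (simp add: algebra_simps)
  then have l1: "l 1 = 0" using t by simp
  then have l3: "l 3 = 0" using \<open>l 1 + l 3 = 0\<close> by simp
  have "l 1 = (\<Sum>a\<in>UNIV. swap_xy $ a $ 1 * l a)"
  proof (rule l)
    fix a :: 3 show "swap_xy $ a $ 3 = (if a = 3 then 1 else 0)"
      using exhaust_3[of a] by (auto simp: swap_xy_def)
  qed (rule swap_xy_O3)
  then have "l 2 = 0" using l1 by (simp add: sum_3 swap_xy_def)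
  with l1 l3 have "l c = 0" using exhaust_3[of c] by auto
  then show ?thesis by (simp add: l_def)
qed

section \<open>A subalgebra of polynomials without a given squarefree term\<close>

text \<open>
  Modulo the monomials that do not divide \<open>\<Prod>M\<close>, such a polynomial is a constant plus multiples
  of \<open>u w\<close>, and the top term \<open>\<Prod>M\<close> itself is missing. Products of two multiples of
  \<open>u w\<close> vanish in this quotient; therefore the top term cannot arise by multiplication.
\<close>

definition avoids :: "'v set \<Rightarrow> 'v \<Rightarrow> 'v \<Rightarrow> ('v, 'k::comm_ring_1) mvpoly \<Rightarrow> bool" where
  "avoids M u w p \<longleftrightarrow>
     (\<forall>S\<subseteq>M. S \<noteq> {} \<and> (u \<in> S \<and> w \<in> S \<longrightarrow> S = M) \<longrightarrow> sqfree_coeff p S = 0)"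

lemma avoidsD:
  assumes "avoids M u w p" "S \<subseteq> M" "S \<noteq> {}" "u \<in> S \<Longrightarrow> w \<in> S \<Longrightarrow> S = M"
  shows "sqfree_coeff p S = 0"
  using assms(1)[unfolded avoids_def, rule_format, of S] assms(2-4) by blast

lemma avoids_Const:
  assumes "finite M"
  shows "avoids M u w (Const c)"
  unfolding avoids_def
proof (intro allI impI)
  fix S assume "S \<subseteq> M" and "S \<noteq> {} \<and> (u \<in> S \<and> w \<in> S \<longrightarrow> S = M)"
  then show "sqfree_coeff (Const c) S = 0"
    using finite_subset[OF _ assms, of S] by (simp add: sqfree_coeff_Const)
qed

lemma avoids_add: "avoids M u w p \<Longrightarrow> avoids M u w q \<Longrightarrow> avoids M u w (p + q)"
  by (simp add: avoids_def sqfree_coeff_add)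

text \<open>
  In a splitting of \<open>S\<close> into \<open>T\<close> and \<open>S - T\<close> at most one part contains both
  \<open>u\<close> and \<open>w\<close>. If a part is empty, the other one is \<open>S\<close>; otherwise a part that
  lacks \<open>u\<close> or \<open>w\<close> is nonempty. In each case one of the two coefficients is zero.
\<close>

lemma avoids_mult:
  assumes M: "finite M" and p: "avoids M u w p" and q: "avoids M u w q"
  shows "avoids M u w (p * q)"
  unfolding avoids_def
proof (intro allI impI)
  fix S assume S: "S \<subseteq> M" "S \<noteq> {} \<and> (u \<in> S \<and> w \<in> S \<longrightarrow> S = M)"
  then have "finite S" using M by (simp add: finite_subset)
  have "(\<Sum>T\<in>Pow S. sqfree_coeff p T * sqfree_coeff q (S - T)) = 0"
  proof (rule sum.neutral, rule ballI)
    fix T assume "T \<in> Pow S"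
    then have T: "T \<subseteq> S" by simp
    show "sqfree_coeff p T * sqfree_coeff q (S - T) = 0"
    proof (cases "T \<noteq> {} \<and> (u \<in> T \<and> w \<in> T \<longrightarrow> T = M)")
      case True
      then have "sqfree_coeff p T = 0"
        using S(1) T by (intro avoidsD[OF p]) simp_all
      then show ?thesis by simp
    next
      case False
      have "sqfree_coeff q (S - T) = 0"
      proof (rule avoidsD[OF q])
        show "S - T \<subseteq> M" using S(1) by blast
        show "S - T \<noteq> {}" using S T False by blast
        show "S - T = M" if "u \<in> S - T" "w \<in> S - T" using S T False that by blast
      qed
      then show ?thesis by simp
    qed
  qed
  then show "sqfree_coeff (p * q) S = 0"
    by (simp only: sqfree_coeff_mult[OF \<open>finite S\<close>])
qed

lemma avoids_subst:
  assumes "finite M" "\<And>v. v \<in> vars P \<Longrightarrow> avoids M u w (f v)"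
  shows "avoids M u w (subst f P)"
  using assms
  by (intro subst_related[where R = "\<lambda>p _. avoids M u w p"] avoids_Const avoids_add avoids_mult)

section \<open>Degree and leading term of the traces\<close>

definition monom_degree :: "('v \<Rightarrow>\<^sub>0 nat) \<Rightarrow> nat" where
  "monom_degree e = (\<Sum>v\<in>Poly_Mapping.keys e. Poly_Mapping.lookup e v)"

lemma monom_degree_superset:
  "finite X \<Longrightarrow> Poly_Mapping.keys e \<subseteq> X \<Longrightarrow> monom_degree e = (\<Sum>v\<in>X. Poly_Mapping.lookup e v)"
  unfolding monom_degree_def by (intro sum.mono_neutral_left) (auto simp: in_keys_iff)

lemma monom_degree_add: "monom_degree (a + b) = monom_degree a + monom_degree b"
proof -
  let ?X = "Poly_Mapping.keys a \<union> Poly_Mapping.keys b"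
  show ?thesis
    using monom_degree_superset[of ?X a] monom_degree_superset[of ?X b]
      monom_degree_superset[of ?X "a + b"] keys_add[of a b]
    by (simp add: lookup_add sum.distrib)
qed

definition degree_le :: "nat \<Rightarrow> ('v, 'k::comm_ring_1) mvpoly \<Rightarrow> bool" where
  "degree_le n p \<longleftrightarrow> (\<forall>e\<in>Poly_Mapping.keys p. monom_degree e \<le> n)"

lemma total_degree_le_iff: "total_degree p \<le> n \<longleftrightarrow> degree_le n p"
  by (auto simp: total_degree_def degree_le_def monom_degree_def)

lemma degree_le_add: "degree_le n p \<Longrightarrow> degree_le n q \<Longrightarrow> degree_le n (p + q)"
  using keys_add[of p q] by (auto simp: degree_le_def)

lemma degree_le_mult: "degree_le n p \<Longrightarrow> degree_le n' q \<Longrightarrow> degree_le (n + n') (p * q)"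
  using keys_mult[of p q] by (fastforce simp: degree_le_def monom_degree_add intro: add_mono)

lemma degree_le_Var: "degree_le 1 (Var v)"
  by (auto simp: degree_le_def Var_def monom_degree_def split: if_splits)

lemma sqfree_coeff_eq_0_of_degree:
  assumes "finite S" "total_degree p < card S"
  shows "sqfree_coeff p S = 0"
proof (rule ccontr)
  assume "sqfree_coeff p S \<noteq> 0"
  then have "squarefree_monom S \<in> Poly_Mapping.keys p"
    by (simp add: sqfree_coeff_def in_keys_iff)
  moreover have "monom_degree (squarefree_monom S) = card S"
    using assms(1) by (simp add: monom_degree_def keys_squarefree_monom lookup_squarefree_monom)
  ultimately have "card S \<le> total_degree p"
    using total_degree_le_iff[of p "total_degree p"] by (auto simp: degree_le_def)
  then show False using assms(2) by simp
qed

abbreviation Vprod :: "nat list \<Rightarrow> (nat \<times> 3, 'k::comm_ring_1) mvpoly ^ 2 ^ 2" where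
  "Vprod idx \<equiv> foldr (\<lambda>i M. Vmat i ** M) idx (mat 1)"

lemma Vmat_mult_row:
  "(Vmat i ** M) $ 1 $ c = Var (i, 3) * M $ 1 $ c + Var (i, 1) * M $ 2 $ c"
  "(Vmat i ** M) $ 2 $ c = Var (i, 2) * M $ 1 $ c + Var (i, 3) * M $ 2 $ c"
  by (simp_all add: matrix_matrix_mult_def sum_2 Vmat_def gvec_def)

lemma degree_le_Vprod:
  "degree_le (length idx) ((Vprod idx :: (nat \<times> 3, 'k::comm_ring_1) mvpoly ^ 2 ^ 2) $ a $ c)"
proof (induction idx arbitrary: a)
  case Nil
  then show ?case
    by (auto simp: mat_def degree_le_def monom_degree_def)
next
  case (Cons i idx)
  have "degree_le (1 + length idx) (Var v * (Vprod idx :: (nat \<times> 3, 'k) mvpoly ^ 2 ^ 2) $ b $ c)" for v b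
    by (intro degree_le_mult degree_le_Var Cons)
  then show ?case
    using exhaust_2[of a] by (auto simp: Vmat_mult_row intro!: degree_le_add)
qed

lemma total_degree_Tr_le:
  "total_degree (Tr idx :: (nat \<times> 3, 'k::comm_ring_1) mvpoly) \<le> length idx"
  unfolding total_degree_le_iff Tr_def trace_def sum_2
  by (intro degree_le_add degree_le_Vprod)

text \<open>
  Every \<open>z\<close> stands on the diagonal, so only the constant path \<open>1 \<rightarrow> 1 \<rightarrow> \<dots> \<rightarrow> 1\<close> contributes.
\<close>

lemma sqfree_coeff_Vprod:
  assumes "distinct idx"
  shows "sqfree_coeff ((Vprod idx :: (nat \<times> 3, 'k::comm_ring_1) mvpoly ^ 2 ^ 2) $ 1 $ 1)
    (zvars (set idx)) = 1"
  using assms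
proof (induction idx)
  case Nil
  then show ?case by (simp add: mat_def sqfree_coeff_one)
next
  case (Cons i idx)
  then have "zvars (set (i # idx)) - {(i, 3)} = zvars (set idx)" by auto
  then show ?case
    using Cons by (simp add: Vmat_mult_row sqfree_coeff_add sqfree_coeff_Var_mult image_iff)
qed

text \<open>
  The only contributing closed path starts with \<open>1 \<rightarrow> 2\<close> (entry \<open>x\<^sub>i\<close>) and
  \<open>2 \<rightarrow> 1\<close> (entry \<open>y\<^sub>j\<close>), and then stays at 1. The monomials without an off-diagonal
  entry occur twice, once for each diagonal position, and cancel in characteristic 2; this is why the
  monomial that is followed contains \<open>x\<^sub>i y\<^sub>j\<close>.
\<close>

lemma sqfree_coeff_Tr:
  assumes "distinct (i # j # idx)"
  shows "sqfree_coeff (Tr (i # j # idx) :: (nat \<times> 3, 'k::comm_ring_1) mvpoly)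
    (insert (i, 1) (insert (j, 2) (zvars (set idx)))) = 1"
proof -
  have "insert (i, 1) (insert (j, 2) (zvars (set idx))) - {(i, 1)}
      = insert (j, 2) (zvars (set idx))"
    "insert (j, 2) (zvars (set idx)) - {(j, 2)} = zvars (set idx)"
    using assms by auto
  then show ?thesis
    using assms
    by (simp add: Tr_def trace_def sum_2 Vmat_mult_row sqfree_coeff_add sqfree_coeff_Var_mult
        sqfree_coeff_Vprod image_iff)
qed

theorem proposition2p3:
  fixes m :: nat and idx :: "nat list"
  assumes "CHAR('k::alg_closed_field) = 2"
    and "set idx \<subseteq> {1..m}"
    and "length idx \<ge> 2"
    and "distinct idx"
  shows "\<not> expressible_by_lower_invariants m (Tr idx :: (nat \<times> 3, 'k) mvpoly)"
proof
  assume "expressible_by_lower_invariants m (Tr idx :: (nat \<times> 3, 'k) mvpoly)"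
  then obtain P :: "(nat, 'k) mvpoly" and f where
    f: "\<And>v. v \<in> vars P \<Longrightarrow> f v \<in> invariants m"
      "\<And>v. v \<in> vars P \<Longrightarrow> total_degree (f v) < total_degree (Tr idx :: (nat \<times> 3, 'k) mvpoly)"
    and Tr: "Tr idx = subst f P"
    unfolding expressible_by_lower_invariants_def by blast
  obtain i j l where idx: "idx = i # j # l"
    using assms(3) by (cases idx; cases "tl idx") auto
  define Z where "Z = zvars (set l)"
  define M where "M = insert (i, 1) (insert (j, 2) Z)"
  have dist: "i \<noteq> j" "i \<notin> set l" "j \<notin> set l" "distinct l"
    using assms(4) idx by auto
  have "finite M" by (simp add: M_def Z_def)
  have "card Z = length l"
    unfolding Z_def using dist by (subst card_image) (auto simp: inj_on_def distinct_card)
  then have "card M = length idx"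
    using dist unfolding M_def idx by (auto simp: Z_def card_insert_if image_iff)
  have "avoids M (i, 1) (j, 2) (f v)" if v: "v \<in> vars P" for v
    unfolding avoids_def
  proof (intro allI impI)
    fix S assume S: "S \<subseteq> M" "S \<noteq> {} \<and> ((i, 1) \<in> S \<and> (j, 2) \<in> S \<longrightarrow> S = M)"
    show "sqfree_coeff (f v) S = 0"
    proof (cases "S = M")
      case True
      have "total_degree (f v) < card M"
        using f(2)[OF v] total_degree_Tr_le[of idx] \<open>card M = length idx\<close>
        by (metis less_le_trans)
      then show ?thesis
        using True \<open>finite M\<close> by (simp add: sqfree_coeff_eq_0_of_degree)
    next
      case False
      define B where "B = {b \<in> set l. (b, 3) \<in> S}"
      have B: "S \<inter> Z = zvars B" "finite B" "B \<subseteq> set l"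
        by (auto simp: B_def Z_def)
      have "\<exists>n c D. S = insert (n, c) (zvars D) \<and> finite D \<and> n \<notin> D"
      proof -
        consider "(i, 1) \<in> S" "(j, 2) \<notin> S" | "(i, 1) \<notin> S" "(j, 2) \<in> S"
          | "(i, 1) \<notin> S" "(j, 2) \<notin> S"
          using S False by auto
        then show ?thesis
        proof cases
          case 1
          then have "S = insert (i, 1) (zvars B)" using S(1) B(1) by (auto simp: M_def)
          then show ?thesis using B dist by blast
        next
          case 2
          then have "S = insert (j, 2) (zvars B)" using S(1) B(1) by (auto simp: M_def)
          then show ?thesis using B dist by blast
        next
          case 3
          \<comment> \<open>Any factor of \<open>z\<^sub>B\<close> can play the part of the distinguished coordinate.\<close>
          then have S': "S = zvars B" using S(1) B(1) by (auto simp: M_def)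
          then obtain b where b: "b \<in> B" using S(2) by auto
          have "S = insert (b, 3) (zvars (B - {b}))" using S' b by auto
          then show ?thesis using B(2) by blast
        qed
      qed
      then show ?thesis
        using sqfree_coeff_invariant_eq_0[OF assms(1) f(1)[OF v]] by blast
    qed
  qed
  then have "avoids M (i, 1) (j, 2) (Tr idx :: (nat \<times> 3, 'k) mvpoly)"
    unfolding Tr by (rule avoids_subst[OF \<open>finite M\<close>])
  then have "sqfree_coeff (Tr idx :: (nat \<times> 3, 'k) mvpoly) M = 0"
    by (auto simp: avoids_def M_def)
  moreover have "sqfree_coeff (Tr idx :: (nat \<times> 3, 'k) mvpoly) M = 1"
    using sqfree_coeff_Tr[of i j l] assms(4) by (simp add: idx M_def Z_def)
  ultimately show False by simp
qed

end
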